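(* Suppose that at iteration $t$ of GROUSE and of partial-data iSVD (both defined in the context), the iterates $U_t$ are the same, and the new observations $v_t$ and $\Omega_t$ are the same. Assume too that $w_t\neq 0$ and $r_t\neq 0$. Define the following (related) scalar quantities: $$\lambda := \tfrac12\left(\|w_t\|^2+\|r_t\|^2+1\right)+\tfrac12\sqrt{\left(\|w_t\|^2+\|r_t\|^2+1\right)^2-4\|r_t\|^2},$$ $$\beta := \frac{\|r_t\|^2+\|w_t\|^2}{\|r_t\|^2+\|w_t\|^2+(\lambda-\|r_t\|^2)^2},$$ $$\alpha := \frac{\|r_t\|\,(\lambda-\|r_t\|^2)}{\|r_t\|^2+\|w_t\|^2+(\lambda-\|r_t\|^2)^2},$$ $$\eta_t := \frac{1}{\sigma_t}\arcsin\beta=\frac{1}{\sigma_t}\arccos(\alpha\|w_t\|),$$ and define the $d\times d$ orthogonal matrix $W_t$ by $$W_t := \left[\frac{w_t}{\|w_t\|}\ \Big|\ Z_t\right],$$ where $Z_t$ is a $d\times(d-1)$ orthonormal matrix whose columns span the orthogonal complement of $w_t$. For these choices of $\eta_t$ (in GROUSE) and $W_t$ (in partial-data iSVD), the iterates $U_{t+1}$ generated by GROUSE and by partial-data iSVD are identical.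
   Context: All vector norms are Euclidean. For a matrix or vector $M$ with $n$ rows, $M_{\Omega}$ denotes its restriction to the rows indexed by $\Omega\subset\{1,\dots,n\}$, and $\Omega^C$ is the complement of $\Omega$ in $\{1,\dots,n\}$. An orthonormal matrix is one with orthonormal columns. Both methods maintain an $n\times d$ matrix $U_t$ with orthonormal columns, $0<d<n$. At iteration $t$ they receive an index set $\Omega_t\subset\{1,\dots,n\}$ and the subvector $(v_t)_{\Omega_t}=(\bar U s_t)_{\Omega_t}$, where $\bar U$ is an (unknown) $n\times d$ matrix with orthonormal columns and $s_t\in\mathbb{R}^d$ is a weight vector. Iteration $t$ of GROUSE. Define $w_t:=\arg\min_w\|(U_t)_{\Omega_t}w-(v_t)_{\Omega_t}\|_2^2$. Define $p_t:=U_tw_t$, $(r_t)_{\Omega_t}:=(v_t)_{\Omega_t}-(p_t)_{\Omega_t}$, $(r_t)_{\Omega_t^C}:=0$, and $\sigma_t:=\|r_t\|\,\|p_t\|$. Choose a steplength $\eta_t>0$ and set $$U_{t+1}:=U_t+\left(\cos(\sigma_t\eta_t)-1\right)\frac{p_t}{\|p_t\|}\frac{w_t^T}{\|w_t\|}+\sin(\sigma_t\eta_t)\frac{r_t}{\|r_t\|}\frac{w_t^T}{\|w_t\|}.$$ Iteration $t$ of partial-data iSVD (incremental SVD for partially observed vectors). Define $w_t:=\arg\min_w\|(U_t)_{\Omega_t}w-(v_t)_{\Omega_t}\|_2^2$. Define $\tilde v_t\in\mathbb{R}^n$ by $[\tilde v_t]_i:=[v_t]_i$ for $i\in\Omega_t$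 and $[\tilde v_t]_i:=[U_tw_t]_i$ for $i\in\Omega_t^C$; set $p_t:=U_tw_t$ and $r_t:=\tilde v_t-p_t$. Compute the singular value decomposition $$\begin{bmatrix} I & w_t\\ 0&\|r_t\|\end{bmatrix}=\tilde U_t\tilde\Sigma_t\tilde V_t^T,$$ with $I$ the $d\times d$ identity, and define $\hat U_t$ to be the $(d+1)\times d$ matrix obtained by removing the last column from $\tilde U_t$. Set $$U_{t+1}:=\begin{bmatrix} U_t & \frac{r_t}{\|r_t\|}\end{bmatrix}\hat U_t W_t,$$ where $W_t$ is an arbitrary $d\times d$ orthogonal matrix.
   Formalization: With N=√(‖r‖²‖w‖²+(λ−‖r‖²)²), the formulas are corrected to β=‖r‖‖w‖/N and α=(λ−‖r‖²)/(‖w‖N); W_t is the transpose of [w_t/‖w_t‖ | Z_t]; "identical" means for a suitable choice of the (non-unique) SVD, with w_t any common minimizer. *)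

theory Defs
  imports
    Complex_Main
    "Jordan_Normal_Form.VS_Connect"
    "Jordan_Normal_Form.DL_Submatrix"
begin

text \<open>Rows, columns and entries are numbered from 0, so index sets are subsets of
  \<open>{..<n}\<close> and the last column of an \<open>m \<times> k\<close> matrix is column \<open>k - 1\<close>.\<close>

definition vnorm :: "real vec \<Rightarrow> real" where
  "vnorm x = sqrt (x \<bullet> x)"

definition normalize_vec :: "real vec \<Rightarrow> real vec" where
  "normalize_vec x = (1 / vnorm x) \<cdot>\<^sub>v x"

text \<open>The library's \<open>orthogonal_mat\<close> does not ask for unit columns. For \<open>m = k\<close> the
  following predicate is the usual notion of an orthogonal matrix.\<close>

definition orthonormal_mat :: "nat \<Rightarrow> nat \<Rightarrow> real mat \<Rightarrow> bool" where
  "orthonormal_mat m k A \<longleftrightarrow> A \<in> carrier_mat m k \<and> A\<^sup>T * A = 1\<^sub>m k"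

definition restrict_rows :: "real mat \<Rightarrow> nat set \<Rightarrow> real mat" where
  "restrict_rows A \<Omega> = submatrix A \<Omega> UNIV"

definition restrict_vec :: "real vec \<Rightarrow> nat set \<Rightarrow> real vec" where
  "restrict_vec x \<Omega> = vec (card {i. i < dim_vec x \<and> i \<in> \<Omega>}) (\<lambda>i. x $ pick \<Omega> i)"

definition outer_prod :: "real vec \<Rightarrow> real vec \<Rightarrow> real mat" where
  "outer_prod x y = mat_of_cols (dim_vec x) [x] * (mat_of_cols (dim_vec y) [y])\<^sup>T"

text \<open>Full singular value decomposition \<open>A = P S Q\<^sup>T\<close>, singular values in decreasing order.\<close>

definition is_svd :: "real mat \<Rightarrow> real mat \<Rightarrow> real mat \<Rightarrow> real mat \<Rightarrow> bool" where
  "is_svd A P S Q \<longleftrightarrow>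
     orthonormal_mat (dim_row A) (dim_row A) P \<and>
     orthonormal_mat (dim_col A) (dim_col A) Q \<and>
     S \<in> carrier_mat (dim_row A) (dim_col A) \<and> diagonal_mat S \<and>
     (\<forall>i < min (dim_row A) (dim_col A). 0 \<le> S $$ (i, i)) \<and>
     (\<forall>i j. i \<le> j \<and> j < min (dim_row A) (dim_col A) \<longrightarrow> S $$ (j, j) \<le> S $$ (i, i)) \<and>
     A = P * S * Q\<^sup>T"

text \<open>The minimizer is unique only if \<open>U\<^sub>\<Omega>\<close> has full column rank, hence a predicate.\<close>

definition ls_weight :: "real mat \<Rightarrow> nat set \<Rightarrow> real vec \<Rightarrow> real vec \<Rightarrow> bool" where
  "ls_weight U \<Omega> v w \<longleftrightarrow>
     is_arg_min (\<lambda>x. (vnorm (restrict_rows U \<Omega> *\<^sub>v x - restrict_vec v \<Omega>))\<^sup>2)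
       (\<lambda>x. x \<in> carrier_vec (dim_col U)) w"

definition grouse_residual :: "real mat \<Rightarrow> nat set \<Rightarrow> real vec \<Rightarrow> real vec \<Rightarrow> real vec" where
  "grouse_residual U \<Omega> v w =
     vec (dim_row U) (\<lambda>i. if i \<in> \<Omega> then v $ i - (U *\<^sub>v w) $ i else 0)"

definition grouse_sigma :: "real mat \<Rightarrow> nat set \<Rightarrow> real vec \<Rightarrow> real vec \<Rightarrow> real" where
  "grouse_sigma U \<Omega> v w = vnorm (grouse_residual U \<Omega> v w) * vnorm (U *\<^sub>v w)"

definition grouse_iterate ::
    "real mat \<Rightarrow> nat set \<Rightarrow> real vec \<Rightarrow> real vec \<Rightarrow> real \<Rightarrow> real mat" where
  "grouse_iterate U \<Omega> v w \<eta> =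
     (let p = U *\<^sub>v w; r = grouse_residual U \<Omega> v w; \<sigma> = grouse_sigma U \<Omega> v w in
      U + (cos (\<sigma> * \<eta>) - 1) \<cdot>\<^sub>m outer_prod (normalize_vec p) (normalize_vec w)
        + sin (\<sigma> * \<eta>) \<cdot>\<^sub>m outer_prod (normalize_vec r) (normalize_vec w))"

definition isvd_residual :: "real mat \<Rightarrow> nat set \<Rightarrow> real vec \<Rightarrow> real vec \<Rightarrow> real vec" where
  "isvd_residual U \<Omega> v w =
     vec (dim_row U) (\<lambda>i. if i \<in> \<Omega> then v $ i else (U *\<^sub>v w) $ i) - U *\<^sub>v w"

definition isvd_core :: "real vec \<Rightarrow> real \<Rightarrow> real mat" where
  "isvd_core w \<rho> =
     four_block_mat (1\<^sub>m (dim_vec w)) (mat_of_cols (dim_vec w) [w])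
                    (0\<^sub>m 1 (dim_vec w)) (mat 1 1 (\<lambda>_. \<rho>))"

text \<open>The singular value decomposition of the core matrix is not unique (signs of the
  singular vectors, basis of the eigenspace of the singular value 1), so for a given \<open>W\<close>
  an iteration has a set of possible results, one for each decomposition.\<close>

definition isvd_iterates ::
    "real mat \<Rightarrow> nat set \<Rightarrow> real vec \<Rightarrow> real vec \<Rightarrow> real mat \<Rightarrow> real mat set" where
  "isvd_iterates U \<Omega> v w W =
     (let r = isvd_residual U \<Omega> v w in
      {mat_of_cols (dim_row U) (cols U @ [normalize_vec r])
         * mat_of_cols (dim_row P) (butlast (cols P)) * W
       | P S Q. is_svd (isvd_core w (vnorm r)) P S Q})"

text \<open>Transpose of the published \<open>[w / \<parallel>w\<parallel> | Z]\<close>. GROUSE multiplies \<open>[U | r / \<parallel>r\<parallel>]\<close> by the block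
  matrix with rows \<open>cos \<theta> \<cdot> w w\<^sup>T / \<parallel>w\<parallel>\<^sup>2 + Z Z\<^sup>T\<close> and \<open>sin \<theta> \<cdot> w\<^sup>T / \<parallel>w\<parallel>\<close>; this factors
  through the singular vectors \<open>(cos \<theta> \<cdot> w / \<parallel>w\<parallel>, sin \<theta>)\<close> and \<open>(z, 0)\<close>, \<open>z\<close> a column of \<open>Z\<close>,
  with the right factor having rows \<open>w\<^sup>T / \<parallel>w\<parallel>\<close> and \<open>Z\<^sup>T\<close>. Without the transpose the iterates
  differ for a general \<open>Z\<close>, whichever singular value decomposition is taken.\<close>

definition aligning_mat :: "real vec \<Rightarrow> real mat \<Rightarrow> real mat" where
  "aligning_mat w Z = (mat_of_cols (dim_vec w) (normalize_vec w # cols Z))\<^sup>T"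

text \<open>Below, \<open>a = \<parallel>w\<parallel>\<close> and \<open>b = \<parallel>r\<parallel>\<close>. The square \<open>lam a b\<close> of the largest singular value of
  the core matrix belongs to the unit left singular vector \<open>(alpha a b \<cdot> w, beta a b)\<close>, which is
  proportional to \<open>((\<lambda> - b\<^sup>2) w / a, a b)\<close>. The published formulas
  \<open>\<beta> = (b\<^sup>2 + a\<^sup>2) / (b\<^sup>2 + a\<^sup>2 + (\<lambda> - b\<^sup>2)\<^sup>2)\<close> and
  \<open>\<alpha> = b (\<lambda> - b\<^sup>2) / (b\<^sup>2 + a\<^sup>2 + (\<lambda> - b\<^sup>2)\<^sup>2)\<close> miss this vector: for \<open>a = b = 1\<close> they give
  \<open>\<alpha>\<^sup>2 a\<^sup>2 + \<beta>\<^sup>2 < 1\<close>, so that \<open>arcsin \<beta> \<noteq> arccos (\<alpha> a)\<close>. They are corrected here: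
  the sum \<open>b\<^sup>2 + a\<^sup>2\<close> becomes the product \<open>b\<^sup>2 a\<^sup>2\<close>, and the vector is scaled to unit length.\<close>

definition lam :: "real \<Rightarrow> real \<Rightarrow> real" where
  "lam a b = (a\<^sup>2 + b\<^sup>2 + 1) / 2 + sqrt ((a\<^sup>2 + b\<^sup>2 + 1)\<^sup>2 - 4 * b\<^sup>2) / 2"

definition beta :: "real \<Rightarrow> real \<Rightarrow> real" where
  "beta a b = b * a / sqrt (b\<^sup>2 * a\<^sup>2 + (lam a b - b\<^sup>2)\<^sup>2)"

definition alpha :: "real \<Rightarrow> real \<Rightarrow> real" where
  "alpha a b = (lam a b - b\<^sup>2) / (a * sqrt (b\<^sup>2 * a\<^sup>2 + (lam a b - b\<^sup>2)\<^sup>2))"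

end

theory Submission
  imports Defs
begin

text \<open>Write \<open>K\<close> for the core matrix, \<open>u = w / \<parallel>w\<parallel>\<close>, \<open>a = \<parallel>w\<parallel>\<close> and \<open>b = \<parallel>r\<parallel>\<close>. The matrix \<open>K K\<^sup>T\<close> fixes
  \<open>(z, 0)\<close> for every \<open>z\<close> orthogonal to \<open>w\<close>, and on the plane spanned by \<open>(u, 0)\<close> and \<open>(0, 1)\<close> it
  acts as the symmetric matrix with rows \<open>(1 + a\<^sup>2, a b)\<close> and \<open>(a b, b\<^sup>2)\<close>. The eigenvalues of the
  latter are \<open>\<lambda> > 1\<close> and \<open>b\<^sup>2 / \<lambda> < 1\<close>, with unit eigenvectors \<open>(cos \<theta>, sin \<theta>)\<close> and
  \<open>(- sin \<theta>, cos \<theta>)\<close>. Hence \<open>(cos \<theta> u, sin \<theta>)\<close>, the vectors \<open>(z, 0)\<close> for the columns \<open>z\<close>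
  of \<open>Z\<close>, and \<open>(- sin \<theta> u, cos \<theta>)\<close> are left singular vectors of \<open>K\<close> in the right order, and the
  last one is discarded. With \<open>B = [u | Z]\<close>, so that \<open>W = B\<^sup>T\<close> and \<open>B B\<^sup>T = I\<close>, it suffices to
  compare the GROUSE iterate times \<open>B\<close> with the iSVD iterate before multiplication by \<open>W\<close>,
  column by column.\<close>

section \<open>Norms and matrices with orthonormal columns\<close>

lemma vnorm_power2: "(vnorm x)\<^sup>2 = x \<bullet> x"
  by (simp add: vnorm_def scalar_prod_def sum_nonneg)

lemma vnorm_pos:
  assumes "x \<in> carrier_vec n" "x \<noteq> 0\<^sub>v n"
  shows "0 < vnorm x"
proof -
  obtain i where i: "i < n" "x $ i \<noteq> 0"
    using assms by (auto simp: vec_eq_iff)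
  have "0 < x $ i * x $ i"
    using i(2) by (metis not_real_square_gt_zero)
  also have "\<dots> \<le> x \<bullet> x"
    unfolding scalar_prod_def using i(1) assms(1)
    by (intro member_le_sum[where f = "\<lambda>j. x $ j * x $ j"]) auto
  finally show ?thesis
    by (simp add: vnorm_def)
qed

lemma normalize_vec_carrier [simp]: "normalize_vec x \<in> carrier_vec n \<longleftrightarrow> x \<in> carrier_vec n"
  unfolding carrier_dim_vec by (simp add: normalize_vec_def)

lemma dim_normalize_vec [simp]: "dim_vec (normalize_vec x) = dim_vec x"
  by (simp add: normalize_vec_def)

lemma normalize_vec_scalar_prod_self:
  assumes "0 < vnorm x"
  shows "normalize_vec x \<bullet> normalize_vec x = 1"
proof -
  have "x \<bullet> x = vnorm x * vnorm x"
    by (simp add: vnorm_power2 flip: power2_eq_square)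
  then show ?thesis
    using assms by (simp add: normalize_vec_def)
qed

lemma orthonormal_mat_iff_cols:
  assumes "A \<in> carrier_mat m k"
  shows "orthonormal_mat m k A \<longleftrightarrow>
    (\<forall>i<k. \<forall>j<k. col A i \<bullet> col A j = (if i = j then 1 else 0))"
proof
  assume "orthonormal_mat m k A"
  then have "(A\<^sup>T * A) $$ (i, j) = 1\<^sub>m k $$ (i, j)" for i j
    by (simp add: orthonormal_mat_def)
  moreover have "(A\<^sup>T * A) $$ (i, j) = col A i \<bullet> col A j" if "i < k" "j < k" for i j
    using assms that by auto
  ultimately have "col A i \<bullet> col A j = (if i = j then 1 else 0)" if "i < k" "j < k" for i j
    using that by (metis index_one_mat(1))
  then show "\<forall>i<k. \<forall>j<k. col A i \<bullet> col A j = (if i = j then 1 else 0)"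
    by blast
next
  assume "\<forall>i<k. \<forall>j<k. col A i \<bullet> col A j = (if i = j then 1 else 0)"
  then show "orthonormal_mat m k A"
    using assms unfolding orthonormal_mat_def by (auto intro!: eq_matI)
qed

lemma orthonormal_mat_square:
  assumes "orthonormal_mat k k A"
  shows "A * A\<^sup>T = 1\<^sub>m k" "orthonormal_mat k k A\<^sup>T"
proof -
  have A: "A \<in> carrier_mat k k" "A\<^sup>T * A = 1\<^sub>m k"
    using assms by (auto simp: orthonormal_mat_def)
  show "A * A\<^sup>T = 1\<^sub>m k"
    using mat_mult_left_right_inverse[of "A\<^sup>T" k A] A by simp
  then show "orthonormal_mat k k A\<^sup>T"
    using A by (simp add: orthonormal_mat_def)
qed

text \<open>For \<open>x = y = w\<close> this gives
  \<open>\<parallel>U w\<parallel> = \<parallel>w\<parallel>\<close>, hence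
  \<open>\<sigma> = \<parallel>r\<parallel> \<parallel>w\<parallel>\<close>.\<close>

lemma orthonormal_mat_scalar_prod:
  assumes "orthonormal_mat m k A" "x \<in> carrier_vec k" "y \<in> carrier_vec k"
  shows "(A *\<^sub>v x) \<bullet> (A *\<^sub>v y) = x \<bullet> y"
proof -
  have A: "A \<in> carrier_mat m k" "A\<^sup>T * A = 1\<^sub>m k"
    using assms(1) by (auto simp: orthonormal_mat_def)
  have "(A *\<^sub>v x) \<bullet> (A *\<^sub>v y) = (A\<^sup>T *\<^sub>v (A *\<^sub>v x)) \<bullet> y"
    using A(1) assms by (intro transpose_vec_mult_scalar[symmetric]) auto
  also have "A\<^sup>T *\<^sub>v (A *\<^sub>v x) = (A\<^sup>T * A) *\<^sub>v x"
    using A(1) assms by (intro assoc_mult_mat_vec[symmetric]) auto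
  finally show ?thesis
    using A(2) assms by simp
qed

section \<open>Scalar multiples and rank-one matrices acting on vectors\<close>

lemma smult_mat_mult_vec:
  assumes "dim_vec x = dim_col A"
  shows "(k \<cdot>\<^sub>m A) *\<^sub>v x = k \<cdot>\<^sub>v (A *\<^sub>v (x :: real vec))"
  using assms by (intro eq_vecI) (auto simp: scalar_prod_def sum_distrib_left mult_ac)

lemma outer_prod_carrier: "outer_prod x y \<in> carrier_mat (dim_vec x) (dim_vec y)"
  by (rule carrier_matI) (simp_all add: outer_prod_def)

lemma outer_prod_index:
  assumes "i < dim_vec x" "j < dim_vec y"
  shows "outer_prod x y $$ (i, j) = x $ i * y $ j"
  using assms by (simp add: outer_prod_def scalar_prod_def mat_of_cols_index)

lemma outer_prod_mult_vec:
  assumes "z \<in> carrier_vec (dim_vec y)"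
  shows "outer_prod x y *\<^sub>v z = (y \<bullet> z) \<cdot>\<^sub>v x"
proof (rule eq_vecI)
  fix i assume "i < dim_vec ((y \<bullet> z) \<cdot>\<^sub>v x)"
  then have i: "i < dim_vec x" by simp
  have d: "dim_row (outer_prod x y) = dim_vec x" "dim_col (outer_prod x y) = dim_vec y"
    using outer_prod_carrier[of x y] by auto
  show "(outer_prod x y *\<^sub>v z) $ i = ((y \<bullet> z) \<cdot>\<^sub>v x) $ i"
    using i assms d
    by (simp add: scalar_prod_def outer_prod_index sum_distrib_left mult_ac)
next
  show "dim_vec (outer_prod x y *\<^sub>v z) = dim_vec ((y \<bullet> z) \<cdot>\<^sub>v x)"
    using outer_prod_carrier[of x y] by auto
qed

section \<open>Block vectors and the core matrix\<close>

text \<open>The block vector \<open>(x, y)\<close> with the scalar last, matching the block splits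
  of \<open>isvd_core\<close> and of \<open>[U | r / \<parallel>r\<parallel>]\<close>.\<close>

definition vsnoc :: "real vec \<Rightarrow> real \<Rightarrow> real vec" where
  "vsnoc x y = x @\<^sub>v vec 1 (\<lambda>_. y)"

lemma dim_vsnoc [simp]: "dim_vec (vsnoc x y) = Suc (dim_vec x)"
  by (simp add: vsnoc_def)

lemma vsnoc_carrier [simp]: "vsnoc x y \<in> carrier_vec (Suc n) \<longleftrightarrow> x \<in> carrier_vec n"
  unfolding carrier_dim_vec by simp

lemma vsnoc_index [simp]:
  "i < dim_vec x \<Longrightarrow> vsnoc x y $ i = x $ i"
  "i = dim_vec x \<Longrightarrow> vsnoc x y $ i = y"
  by (simp_all add: vsnoc_def)

lemma scalar_prod_vsnoc:
  assumes "dim_vec x = dim_vec x'"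
  shows "vsnoc x y \<bullet> vsnoc x' y' = x \<bullet> x' + y * y'"
  using assms by (simp add: scalar_prod_def)

lemma smult_vsnoc: "k \<cdot>\<^sub>v vsnoc x y = vsnoc (k \<cdot>\<^sub>v x) (k * y)"
  by (rule eq_vecI) (auto simp: less_Suc_eq)

lemma mat_of_cols_snoc_mult_vec:
  assumes "U \<in> carrier_mat n d" "r \<in> carrier_vec n" "x \<in> carrier_vec d"
  shows "mat_of_cols n (cols U @ [r]) *\<^sub>v vsnoc x y = U *\<^sub>v x + y \<cdot>\<^sub>v r"
  using assms
  by (intro eq_vecI) (auto simp: scalar_prod_def mat_of_cols_index nth_append)

lemma isvd_core_carrier:
  "isvd_core w b \<in> carrier_mat (Suc (dim_vec w)) (Suc (dim_vec w))"
  by (rule carrier_matI) (simp_all add: isvd_core_def)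

lemma isvd_core_index:
  assumes "i \<le> dim_vec w" "j \<le> dim_vec w"
  shows "isvd_core w b $$ (i, j) =
    (if j < dim_vec w then (if i = j then 1 else 0) else if i < dim_vec w then w $ i else b)"
  using assms by (auto simp: isvd_core_def mat_of_cols_index)

text \<open>With the transposed version below, this evaluates \<open>K K\<^sup>T\<close> on a block
  vector: the transpose produces the scalar \<open>w \<bullet> x + b * y\<close>, which
  \<open>K\<close> then feeds into both blocks.\<close>

lemma isvd_core_mult_vsnoc:
  assumes "x \<in> carrier_vec (dim_vec w)"
  shows "isvd_core w b *\<^sub>v vsnoc x y = vsnoc (x + y \<cdot>\<^sub>v w) (b * y)"
proof (rule eq_vecI)
  have K: "dim_row (isvd_core w b) = Suc (dim_vec w)" "dim_col (isvd_core w b) = Suc (dim_vec w)"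
    using isvd_core_carrier[of w b] by auto
  then show "dim_vec (isvd_core w b *\<^sub>v vsnoc x y) = dim_vec (vsnoc (x + y \<cdot>\<^sub>v w) (b * y))"
    by simp
  fix i assume "i < dim_vec (vsnoc (x + y \<cdot>\<^sub>v w) (b * y))"
  then have "i \<le> dim_vec w" by simp
  then show "(isvd_core w b *\<^sub>v vsnoc x y) $ i = vsnoc (x + y \<cdot>\<^sub>v w) (b * y) $ i"
    using K assms by (auto simp: scalar_prod_def isvd_core_index if_distrib[of "\<lambda>u. u * _"] cong: if_cong)
qed

lemma isvd_core_transpose_mult_vsnoc:
  assumes "x \<in> carrier_vec (dim_vec w)"
  shows "(isvd_core w b)\<^sup>T *\<^sub>v vsnoc x y = vsnoc x (w \<bullet> x + b * y)"
proof (rule eq_vecI)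
  have K: "dim_row (isvd_core w b) = Suc (dim_vec w)" "dim_col (isvd_core w b) = Suc (dim_vec w)"
    using isvd_core_carrier[of w b] by auto
  then show "dim_vec ((isvd_core w b)\<^sup>T *\<^sub>v vsnoc x y) = dim_vec (vsnoc x (w \<bullet> x + b * y))"
    using assms by simp
  fix i assume "i < dim_vec (vsnoc x (w \<bullet> x + b * y))"
  then have "i \<le> dim_vec w" using assms by simp
  then show "((isvd_core w b)\<^sup>T *\<^sub>v vsnoc x y) $ i = vsnoc x (w \<bullet> x + b * y) $ i"
    using K assms by (auto simp: scalar_prod_def isvd_core_index if_distrib[of "\<lambda>u. u * _"] cong: if_cong)
qed

section \<open>Singular value decomposition of the core matrix\<close>

text \<open>With \<open>S\<close> the diagonal of square roots of the eigenvalues,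
  \<open>A = P S Q\<^sup>T\<close> forces \<open>Q = A\<^sup>T P S\<^sup>-\<^sup>1\<close>. All
  eigenvalues are positive, so \<open>S\<close> is invertible and this \<open>Q\<close> is already a
  full orthogonal matrix; no completion of a basis is involved.\<close>

lemma is_svd_of_eigenbasis:
  fixes A P :: "real mat" and l :: "nat \<Rightarrow> real"
  assumes A: "A \<in> carrier_mat m m" and P: "orthonormal_mat m m P"
    and eig: "\<And>j. j < m \<Longrightarrow> A *\<^sub>v (A\<^sup>T *\<^sub>v col P j) = l j \<cdot>\<^sub>v col P j"
    and pos: "\<And>j. j < m \<Longrightarrow> 0 < l j"
    and dec: "\<And>i j. i \<le> j \<Longrightarrow> j < m \<Longrightarrow> l j \<le> l i"
  shows "\<exists>S Q. is_svd A P S Q"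
proof -
  define D where "D f = mat m m (\<lambda>(i, j). if i = j then f j else 0)" for f :: "nat \<Rightarrow> real"
  have D [simp]: "D f \<in> carrier_mat m m" for f by (simp add: D_def)
  have D_T: "(D f)\<^sup>T = D f" for f by (rule eq_matI) (auto simp: D_def)
  have DD: "D f * D g = D (\<lambda>i. f i * g i)" for f g
    by (rule eq_matI)
      (auto simp: D_def scalar_prod_def if_distrib[of "\<lambda>u. u * _"] cong: if_cong)
  have D1: "D f = 1\<^sub>m m" if "\<And>i. i < m \<Longrightarrow> f i = 1" for f
    using that by (intro eq_matI) (auto simp: D_def)
  have Pc [simp]: "P \<in> carrier_mat m m" and PTP: "P\<^sup>T * P = 1\<^sub>m m"
    using P by (auto simp: orthonormal_mat_def)
  note PPT = orthonormal_mat_square(1)[OF P]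
  have [simp]: "A\<^sup>T \<in> carrier_mat m m" "P\<^sup>T \<in> carrier_mat m m" using A Pc by auto
  define S where "S = D (\<lambda>i. sqrt (l i))"
  define T where "T = D (\<lambda>i. 1 / sqrt (l i))"
  have [simp]: "S \<in> carrier_mat m m" "T \<in> carrier_mat m m" by (simp_all add: S_def T_def)
  have sqrt_l: "sqrt (l i) * sqrt (l i) = l i" "sqrt (l i) \<noteq> 0" if "i < m" for i
    using pos[OF that] by simp_all
  have ST: "S * T = 1\<^sub>m m"
    unfolding S_def T_def DD using sqrt_l(2) by (intro D1) simp
  have TST: "T * D l * T = 1\<^sub>m m"
    unfolding T_def DD
  proof (rule D1)
    fix i assume "i < m"
    from sqrt_l[OF this] show "1 / sqrt (l i) * l i * (1 / sqrt (l i)) = 1"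
      by (simp add: field_simps)
  qed
  have eigP: "A * (A\<^sup>T * P) = P * D l"
  proof (rule mat_col_eqI)
    fix j assume "j < dim_col (P * D l)"
    then have j: "j < m" by (simp add: D_def)
    have "col (A * (A\<^sup>T * P)) j = A *\<^sub>v (A\<^sup>T *\<^sub>v col P j)"
      using A Pc j by (simp add: col_mult2[of _ m m _ m] del: col_mult2)
    also have "\<dots> = col (P * D l) j"
      unfolding eig[OF j] using carrier_matD[OF Pc] j
      by (intro eq_vecI)
        (auto simp: D_def scalar_prod_def if_distrib[of "\<lambda>u. _ * u"] cong: if_cong)
    finally show "col (A * (A\<^sup>T * P)) j = col (P * D l) j" .
  qed (use A carrier_matD[OF Pc] in \<open>auto simp: D_def\<close>)
  \<comment> \<open>The eigenvalue equation makes the columns of \<open>A\<^sup>T P S\<^sup>-\<^sup>1\<close> orthonormal.\<close>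
  define Q where "Q = A\<^sup>T * P * T"
  have Q [simp]: "Q \<in> carrier_mat m m"
    unfolding Q_def by (intro mult_carrier_mat[of _ m m]) (simp_all add: A)
  have QT: "Q\<^sup>T = T * (P\<^sup>T * A)"
    unfolding Q_def using A
    by (simp add: transpose_mult[of _ m m _ m] D_T T_def)
  have "Q\<^sup>T * Q = T * (P\<^sup>T * (A * (A\<^sup>T * P))) * T"
    unfolding QT unfolding Q_def using A
    by (simp add: assoc_mult_mat[of _ m m _ m _ m] mult_carrier_mat[of _ m m _ m])
  also have "P\<^sup>T * (A * (A\<^sup>T * P)) = (P\<^sup>T * P) * D l"
    unfolding eigP by (simp add: assoc_mult_mat[of _ m m _ m _ m] mult_carrier_mat[of _ m m _ m])
  also have "T * ((P\<^sup>T * P) * D l) * T = 1\<^sub>m m"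
    unfolding PTP left_mult_one_mat[OF D] by (rule TST)
  finally have "orthonormal_mat m m Q" by (simp add: orthonormal_mat_def)
  moreover have "A = P * S * Q\<^sup>T"
  proof -
    \<comment> \<open>\<open>S\<close> and its inverse \<open>T\<close> cancel, and
      \<open>P P\<^sup>T = 1\<close> because \<open>P\<close> is square.\<close>
    have "P * S * Q\<^sup>T = P * ((S * T) * (P\<^sup>T * A))"
      unfolding QT using A by (simp add: assoc_mult_mat[of _ m m _ m _ m] mult_carrier_mat[of _ m m _ m])
    also have "\<dots> = (P * P\<^sup>T) * A"
      unfolding ST using A by (simp add: left_mult_one_mat[of _ m m] assoc_mult_mat[of _ m m _ m _ m] mult_carrier_mat[of _ m m _ m])
    finally show ?thesis unfolding PPT using A by simp
  qed
  moreover have "diagonal_mat S" by (auto simp: S_def D_def diagonal_mat_def)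
  moreover have "S $$ (i, i) = sqrt (l i)" if "i < m" for i
    using that by (simp add: S_def D_def)
  ultimately have "is_svd A P S Q"
    using P pos dec unfolding is_svd_def carrier_matD[OF A] by (simp add: less_imp_le)
  then show ?thesis by blast
qed


text \<open>The pair \<open>(c, s)\<close> stands for \<open>(cos \<theta>, sin \<theta>)\<close>.
  The assumptions \<open>first\<close> and \<open>last\<close> are the eigenvalue equations of the
  two-by-two matrix for \<open>(c, s)\<close> and \<open>(- s, c)\<close>, with the scalar produced
  by \<open>K\<^sup>T\<close> left unexpanded. By \<open>order\<close>, the eigenvalue 1 of the
  vectors \<open>(z, 0)\<close> lies between \<open>M\<close> and \<open>L\<close>, so the vector to
  be discarded comes last.\<close>

lemma isvd_core_svd:
  fixes B :: "real mat" and a b c s L M :: real and d :: nat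
  defines "p \<equiv> \<lambda>j. if j = 0 then vsnoc (c \<cdot>\<^sub>v col B 0) s
                   else if j < d then vsnoc (col B j) 0 else vsnoc ((- s) \<cdot>\<^sub>v col B 0) c"
  assumes "0 < d" and B: "orthonormal_mat d d B" and w: "w = a \<cdot>\<^sub>v col B 0"
    and unit: "c\<^sup>2 + s\<^sup>2 = 1"
    and first: "c + a * (a * c + b * s) = L * c" "b * (a * c + b * s) = L * s"
    and last: "- s + a * (b * c - a * s) = - (M * s)" "b * (b * c - a * s) = M * c"
    and order: "1 \<le> L" "M \<le> 1" "0 < M"
  shows "\<exists>S Q. is_svd (isvd_core w b) (mat_of_cols (Suc d) (map p [0..<Suc d])) S Q"
proof -
  define P where "P = mat_of_cols (Suc d) (map p [0..<Suc d])"
  have Bc: "B \<in> carrier_mat d d" using B by (simp add: orthonormal_mat_def)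
  have dim_B: "dim_row B = d" using Bc by simp
  have BB: "col B i \<bullet> col B j = (if i = j then 1 else 0)" if "i < d" "j < d" for i j
    using B orthonormal_mat_iff_cols[OF Bc] that by blast
  have dw: "dim_vec w = d" using Bc w by simp
  have p_carrier: "p j \<in> carrier_vec (Suc d)" for j
    using Bc by (intro carrier_vecI) (auto simp: p_def)
  have P: "P \<in> carrier_mat (Suc d) (Suc d)" by (rule carrier_matI) (simp_all add: P_def)
  have col_P: "col P j = p j" if "j < Suc d" for j
    unfolding P_def using that p_carrier
    by (subst col_mat_of_cols) (auto simp del: upt_Suc)
  have "col P i \<bullet> col P j = (if i = j then 1 else 0)" if "i < Suc d" "j < Suc d" for i j
    using that \<open>0 < d\<close> unit BB
    by (auto simp: col_P p_def scalar_prod_vsnoc dim_B power2_eq_square)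
  then have oP: "orthonormal_mat (Suc d) (Suc d) P"
    using orthonormal_mat_iff_cols[OF P] by blast
  define l where "l j = (if j = 0 then L else if j < d then 1 else M)" for j
  have KK: "isvd_core w b *\<^sub>v ((isvd_core w b)\<^sup>T *\<^sub>v vsnoc x y) =
      vsnoc (x + (w \<bullet> x + b * y) \<cdot>\<^sub>v w) (b * (w \<bullet> x + b * y))"
    if "dim_vec x = d" for x y
    using carrier_vecI[OF that] dw
    by (simp add: isvd_core_transpose_mult_vsnoc isvd_core_mult_vsnoc)
  have wB: "w \<bullet> (k \<cdot>\<^sub>v col B j) = (if j = 0 then a * k else 0)" if "j < d" for j k
    using that BB \<open>0 < d\<close> by (simp add: w dim_B)
  have wB': "w \<bullet> col B j = (if j = 0 then a else 0)" if "j < d" for j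
    using that BB \<open>0 < d\<close> by (simp add: w dim_B)
  have "isvd_core w b *\<^sub>v ((isvd_core w b)\<^sup>T *\<^sub>v col P j) = l j \<cdot>\<^sub>v col P j"
    if j: "j < Suc d" for j
  proof -
    have "isvd_core w b *\<^sub>v ((isvd_core w b)\<^sup>T *\<^sub>v p j) = l j \<cdot>\<^sub>v p j"
    proof -
      \<comment> \<open>Three kinds of eigenvectors: the dominant one of the plane, those orthogonal
        to \<open>w\<close>, on which \<open>K K\<^sup>T\<close> is the identity, and the remaining
        one of the plane.\<close>
      consider "j = 0" | "0 < j" "j < d" | "j = d" using j by linarith
      then show ?thesis
      proof cases
        case 1
        have "c \<cdot>\<^sub>v col B 0 + (a * c + b * s) \<cdot>\<^sub>v w = (L * c) \<cdot>\<^sub>v col B 0"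
          unfolding w smult_smult_assoc add_smult_distrib_vec[symmetric]
          using first(1) by (simp add: mult.commute)
        then show ?thesis
          using 1 \<open>0 < d\<close> first(2)
          by (simp add: p_def l_def KK dim_B wB smult_vsnoc smult_smult_assoc)
      next
        case 2
        have "col B j + 0 \<cdot>\<^sub>v w = col B j"
          using dw Bc by (intro eq_vecI) auto
        then show ?thesis
          using 2 by (simp add: p_def l_def KK dim_B wB')
      next
        case 3
        have "(- s) \<cdot>\<^sub>v col B 0 + (a * (- s) + b * c) \<cdot>\<^sub>v w = (M * (- s)) \<cdot>\<^sub>v col B 0"
        proof -
          have coeff: "- s + (a * (- s) + b * c) * a = M * (- s)"
            using last(1) by (simp add: algebra_simps)
          show ?thesis
            unfolding w smult_smult_assoc add_smult_distrib_vec[symmetric] coeff ..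
        qed
        moreover have "b * (a * (- s) + b * c) = M * c"
          using last(2) by (simp add: algebra_simps)
        ultimately show ?thesis
          using 3 \<open>0 < d\<close>
          by (simp del: mult_minus_right add: p_def l_def KK dim_B wB smult_vsnoc smult_smult_assoc)
      qed
    qed
    then show ?thesis using col_P[OF j] by simp
  qed
  moreover have "0 < l j" for j using order by (simp add: l_def)
  moreover have "l j \<le> l i" if "i \<le> j" for i j using that order by (simp add: l_def)
  ultimately show ?thesis
    unfolding P_def[symmetric] using isvd_core_carrier[of w b] dw oP
    by (intro is_svd_of_eigenbasis[of _ "Suc d"]) auto
qed

section \<open>Eigenvalues and eigenvectors of the two-by-two matrix\<close>

text \<open>\<open>lam a b\<close> is the larger root of the characteristic polynomial of the
  two-by-two matrix, whose trace is \<open>a\<^sup>2 + b\<^sup>2 + 1\<close> and whose determinant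
  is \<open>b\<^sup>2\<close>.\<close>

lemma lam_props:
  assumes "0 < a" "0 < b"
  shows "(lam a b)\<^sup>2 = (a\<^sup>2 + b\<^sup>2 + 1) * lam a b - b\<^sup>2" "1 < lam a b" "b\<^sup>2 < lam a b"
proof -
  define D where "D = (a\<^sup>2 + b\<^sup>2 + 1)\<^sup>2 - 4 * b\<^sup>2"
  \<comment> \<open>Difference of squares: the factors are
    \<open>a\<^sup>2 + b\<^sup>2 + 1 - 2 b\<close> and
    \<open>a\<^sup>2 + b\<^sup>2 + 1 + 2 b\<close>, both sums of squares.\<close>
  have "D = (a\<^sup>2 + (b - 1)\<^sup>2) * (a\<^sup>2 + (b + 1)\<^sup>2)"
    by (simp add: D_def power2_eq_square algebra_simps)
  then have "0 \<le> D" by simp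
  have L: "lam a b = (a\<^sup>2 + b\<^sup>2 + 1) / 2 + sqrt D / 2"
    by (simp add: lam_def D_def)
  have "(2 * lam a b - (a\<^sup>2 + b\<^sup>2 + 1))\<^sup>2 = D"
  proof -
    have "2 * lam a b - (a\<^sup>2 + b\<^sup>2 + 1) = sqrt D" by (simp add: L field_simps)
    then show ?thesis using \<open>0 \<le> D\<close> by simp
  qed
  then show quad: "(lam a b)\<^sup>2 = (a\<^sup>2 + b\<^sup>2 + 1) * lam a b - b\<^sup>2"
    by (simp add: D_def power2_eq_square algebra_simps)
  have pos: "0 < lam a b"
    using \<open>0 \<le> D\<close> unfolding L by (intro add_pos_nonneg) (auto intro: add_nonneg_pos)
  \<comment> \<open>Both factors are positive because their product and their sum are.\<close>
  have "(lam a b - 1) * (lam a b - b\<^sup>2) = a\<^sup>2 * lam a b"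
    using quad by (simp add: power2_eq_square algebra_simps)
  then have prod: "0 < (lam a b - 1) * (lam a b - b\<^sup>2)"
    using pos assms by simp
  have "2 * lam a b = a\<^sup>2 + b\<^sup>2 + 1 + sqrt D" by (simp add: L field_simps)
  moreover have "0 < a\<^sup>2" "0 \<le> sqrt D" using assms \<open>0 \<le> D\<close> by auto
  ultimately have sum: "0 < (lam a b - 1) + (lam a b - b\<^sup>2)" by linarith
  show "1 < lam a b" "b\<^sup>2 < lam a b"
    using prod sum by (auto simp: zero_less_mult_iff)
qed

text \<open>\<open>(c, s)\<close> is the unit multiple of \<open>(L - b\<^sup>2, a b)\<close>, which
  satisfies the second row of the eigenvalue equation identically and the first row by the quadratic
  equation for \<open>L\<close>. Since the determinant is \<open>b\<^sup>2\<close>, the other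
  eigenvalue is \<open>b\<^sup>2 / L\<close>, and by symmetry its eigenvector is orthogonal to the
  first.\<close>

lemma alpha_beta_props:
  assumes a: "0 < a" and b: "0 < b"
  defines "c \<equiv> alpha a b * a" and "s \<equiv> beta a b" and "L \<equiv> lam a b"
  shows "0 < c" "0 < s" "c\<^sup>2 + s\<^sup>2 = 1"
    and "c + a * (a * c + b * s) = L * c" "b * (a * c + b * s) = L * s"
    and "- s + a * (b * c - a * s) = - (b\<^sup>2 / L * s)" "b * (b * c - a * s) = b\<^sup>2 / L * c"
proof -
  note L = lam_props[OF a b, folded L_def]
  define N where "N = sqrt (b\<^sup>2 * a\<^sup>2 + (L - b\<^sup>2)\<^sup>2)"
  have "0 < b\<^sup>2 * a\<^sup>2 + (L - b\<^sup>2)\<^sup>2"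
    using a b by (intro add_pos_nonneg) auto
  then have N: "0 < N" "N\<^sup>2 = b\<^sup>2 * a\<^sup>2 + (L - b\<^sup>2)\<^sup>2" by (auto simp: N_def)
  have c: "c = (L - b\<^sup>2) / N" and s: "s = b * a / N"
    using a by (simp_all add: c_def s_def alpha_def beta_def N_def L_def)
  show "0 < c" "0 < s" using a b N L by (simp_all add: c s)
  have "c\<^sup>2 + s\<^sup>2 = (b\<^sup>2 * a\<^sup>2 + (L - b\<^sup>2)\<^sup>2) / N\<^sup>2"
    by (simp add: c s power_divide power_mult_distrib add_divide_distrib)
  also have "\<dots> = N\<^sup>2 / N\<^sup>2" using N(2) by simp
  finally show "c\<^sup>2 + s\<^sup>2 = 1" using N(1) by simp
  have quad: "L * L = (a * a + b * b + 1) * L - b * b"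
    using L(1) by (simp add: power2_eq_square)
  have Nc: "N * c = L - b * b" and Ns: "N * s = b * a"
    using N by (simp_all add: c s power2_eq_square)
  \<comment> \<open>The eigenvalue equations are verified after multiplication by \<open>N\<close>,
    or by \<open>L N\<close> for the smaller eigenvalue. This clears the denominators and leaves
    polynomial identities in \<open>a\<close>, \<open>b\<close>, \<open>L\<close> modulo
    \<open>quad\<close>.\<close>
  have scale: "x = y" if "N * x = N * y" for x y using that N by simp
  have scale': "x = y" if "L * (N * x) = L * (N * y)" for x y using that N L by simp
  have "N * (c + a * (a * c + b * s)) = N * c + a * (a * (N * c) + b * (N * s))"
    by (simp add: algebra_simps)
  also have "\<dots> = L * (N * c)"
    unfolding Nc Ns using quad by (simp add: algebra_simps)
  finally show "c + a * (a * c + b * s) = L * c"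
    by - (rule scale, simp add: algebra_simps)
  have "N * (b * (a * c + b * s)) = b * (a * (N * c) + b * (N * s))"
    by (simp add: algebra_simps)
  also have "\<dots> = L * (N * s)"
    unfolding Nc Ns by (simp add: algebra_simps)
  finally show "b * (a * c + b * s) = L * s"
    by - (rule scale, simp add: algebra_simps)
  have "L * (N * (- s + a * (b * c - a * s)))
      = L * (- (N * s) + a * (b * (N * c) - a * (N * s)))"
    by (simp add: algebra_simps)
  also have "\<dots> = a * b * (L * L - (a * a + b * b + 1) * L)"
    unfolding Nc Ns by (simp add: algebra_simps)
  also have "\<dots> = - (b * b * (N * s))"
    unfolding quad Ns by (simp add: algebra_simps)
  also have "\<dots> = L * (N * (- (b\<^sup>2 / L * s)))"
    using L by (simp add: power2_eq_square)
  finally show "- s + a * (b * c - a * s) = - (b\<^sup>2 / L * s)"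
    by (rule scale')
  have "L * (N * (b * (b * c - a * s))) = L * (b * (b * (N * c) - a * (N * s)))"
    by (simp add: algebra_simps)
  also have "\<dots> = b * b * (L * L - (a * a + b * b) * L)"
    unfolding Nc Ns by (simp add: algebra_simps)
  also have "\<dots> = b * b * (N * c)"
    unfolding quad Nc by (simp add: algebra_simps)
  also have "\<dots> = L * (N * (b\<^sup>2 / L * c))"
    using L by (simp add: power2_eq_square)
  finally show "b * (b * c - a * s) = b\<^sup>2 / L * c"
    by (rule scale')
qed

section \<open>Comparison of the two iterates\<close>

text \<open>Off \<open>\<Omega>\<close> the completed vector copies the prediction
  \<open>U w\<close>, so subtracting \<open>U w\<close> leaves the zeros that GROUSE
  prescribes.\<close>

lemma isvd_residual_eq_grouse_residual: "isvd_residual U \<Omega> v w = grouse_residual U \<Omega> v w"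
  by (intro eq_vecI) (auto simp: isvd_residual_def grouse_residual_def)

text \<open>Turns the hypothesis on the column space of \<open>Z\<close> into orthogonality of each
  single column to \<open>w\<close>.\<close>

lemma col_in_col_space:
  assumes "A \<in> carrier_mat m k" "j < k"
  shows "col A j \<in> vec_space.col_space m (A :: real mat)"
proof -
  interpret vec_space "TYPE(real)" m .
  have "set (cols A) \<subseteq> carrier_vec m" using assms cols_dim[of A] by auto
  moreover have "col A j \<in> set (cols A)" using assms by (auto simp: cols_def)
  ultimately show ?thesis
    unfolding col_space_def using in_own_span by blast
qed

text \<open>Applied with \<open>k = d - 1\<close>: the direction of \<open>w\<close> fills the one
  dimension missing from \<open>Z\<close>, so \<open>B\<close> is square and its transpose is its
  inverse.\<close>

lemma orthonormal_mat_Cons_col: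
  assumes u: "u \<in> carrier_vec (Suc k)" "u \<bullet> u = 1"
    and Z: "orthonormal_mat (Suc k) k Z" and perp: "\<And>j. j < k \<Longrightarrow> u \<bullet> col Z j = 0"
  shows "orthonormal_mat (Suc k) (Suc k) (mat_of_cols (Suc k) (u # cols Z))"
proof -
  let ?B = "mat_of_cols (Suc k) (u # cols Z)"
  have Zc: "Z \<in> carrier_mat (Suc k) k" using Z by (simp add: orthonormal_mat_def)
  then have B: "?B \<in> carrier_mat (Suc k) (Suc k)" by (intro carrier_matI) auto
  have col_B: "col ?B j = (if j = 0 then u else col Z (j - 1))" if "j < Suc k" for j
    using that Zc u by (subst col_mat_of_cols) (auto simp: nth_Cons' intro!: carrier_vecI)
  have ZZ: "col Z i \<bullet> col Z j = (if i = j then 1 else 0)" if "i < k" "j < k" for i j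
    using Z orthonormal_mat_iff_cols[OF Zc] that by blast
  have perp': "col Z j \<bullet> u = 0" if "j < k" for j
    using perp[OF that] comm_scalar_prod[OF u(1), of "col Z j"] carrier_vecI[of "col Z j"] Zc by simp
  have "col ?B i \<bullet> col ?B j = (if i = j then 1 else 0)" if "i < Suc k" "j < Suc k" for i j
    unfolding col_B[OF that(1)] col_B[OF that(2)]
    using that perp[of "j - 1"] perp'[of "i - 1"] ZZ[of "i - 1" "j - 1"] u(2) by auto
  then show ?thesis using orthonormal_mat_iff_cols[OF B] by blast
qed

theorem theorem1:
  fixes n d :: nat and U Ubar Z W :: "real mat" and s v w r :: "real vec"
    and \<Omega> :: "nat set" and \<sigma> \<eta> :: real
  assumes "0 < d" and "d < n"
    and "orthonormal_mat n d U"
    and "orthonormal_mat n d Ubar" and "s \<in> carrier_vec d" and "v = Ubar *\<^sub>v s"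
    and "\<Omega> \<subseteq> {..<n}"
    and "ls_weight U \<Omega> v w" and "w \<noteq> 0\<^sub>v d"
    and "r = grouse_residual U \<Omega> v w" and "r \<noteq> 0\<^sub>v n"
    and "\<sigma> = grouse_sigma U \<Omega> v w"
    and "\<eta> = 1 / \<sigma> * arcsin (beta (vnorm w) (vnorm r))"
    and "orthonormal_mat d (d - 1) Z"
    and "vec_space.col_space d Z = vec_module.orthogonal_complement d {w}"
    and "W = aligning_mat w Z"
  shows "\<eta> = 1 / \<sigma> * arccos (alpha (vnorm w) (vnorm r) * vnorm w) \<and> 0 < \<eta> \<and>
         orthonormal_mat d d W \<and>
         grouse_iterate U \<Omega> v w \<eta> \<in> isvd_iterates U \<Omega> v w W"
proof -
  define a b u where "a = vnorm w" and "b = vnorm r" and "u = normalize_vec w"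
  \<comment> \<open>The cosine and the sine of the GROUSE rotation angle; \<open>s\<close> already
    names the weight vector.\<close>
  define c t where "c = alpha a b * a" and "t = beta a b"
  define B where "B = mat_of_cols d (u # cols Z)"
  have U: "U \<in> carrier_mat n d" using assms(3) by (simp add: orthonormal_mat_def)
  have Z: "Z \<in> carrier_mat d (d - 1)" using assms(14) by (simp add: orthonormal_mat_def)
  have w: "w \<in> carrier_vec d"
    using assms(8) U by (simp add: ls_weight_def is_arg_min_def)
  have r: "r \<in> carrier_vec n"
    using assms(10) U by (simp add: grouse_residual_def)
  have a: "0 < a" and b: "0 < b"
    using vnorm_pos[OF w assms(9)] vnorm_pos[OF r assms(11)] by (simp_all add: a_def b_def)
  note ct = alpha_beta_props[OF a b, folded c_def t_def]
  note L = lam_props[OF a b]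
  have u: "u \<in> carrier_vec d" "u \<bullet> u = 1"
    using w normalize_vec_scalar_prod_self a by (simp_all add: u_def a_def)
  have wu: "w = a \<cdot>\<^sub>v u"
    using a by (simp add: u_def normalize_vec_def a_def smult_smult_assoc)
  have norm_Uw: "vnorm (U *\<^sub>v w) = a"
    using orthonormal_mat_scalar_prod[OF assms(3) w w] by (simp add: vnorm_def a_def)
  have \<sigma>: "\<sigma> = b * a"
    using assms(10,12) norm_Uw by (simp add: grouse_sigma_def b_def)
  then have "0 < \<sigma>" using a b by simp
  have t_le: "t \<le> 1"
  proof (rule power2_le_imp_le)
    show "t\<^sup>2 \<le> 1\<^sup>2" unfolding one_power2 using ct(3) zero_le_power2[of c] by linarith
  qed simp
  define \<theta> where "\<theta> = arcsin t"
  have \<theta>: "0 < \<theta>" "\<theta> \<le> pi / 2"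
    using ct(2) t_le arcsin_less_arcsin[of 0 t] arcsin_bounded[of t] by (simp_all add: \<theta>_def)
  have sin: "sin \<theta> = t" using ct(2) t_le by (simp add: \<theta>_def)
  \<comment> \<open>The cosine of an arcsine is a nonnegative root, and \<open>0 < c\<close>
    identifies it as \<open>c\<close>.\<close>
  have cos: "cos \<theta> = c"
  proof -
    have "cos \<theta> = sqrt (1 - t\<^sup>2)" using ct(2) t_le by (simp add: \<theta>_def cos_arcsin)
    also have "1 - t\<^sup>2 = c\<^sup>2" using ct(3) by simp
    finally show ?thesis using ct(1) by simp
  qed
  have \<eta>: "\<eta> = 1 / \<sigma> * \<theta>"
    using assms(13) by (simp add: \<theta>_def t_def a_def b_def)
  have \<sigma>\<eta>: "\<sigma> * \<eta> = \<theta>" using \<open>0 < \<sigma>\<close> by (simp add: \<eta>)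
  \<comment> \<open>\<open>\<theta>\<close> lies in the range of arccos, so the two forms of the
    steplength agree.\<close>
  have "arccos c = \<theta>"
    using \<theta> by (simp flip: cos add: arccos_cos)
  then have eta_arccos: "\<eta> = 1 / \<sigma> * arccos (alpha (vnorm w) (vnorm r) * vnorm w)"
    using \<eta> by (simp add: c_def a_def b_def)
  have perp: "u \<bullet> col Z j = 0" if "j < d - 1" for j
  proof -
    have "col Z j \<in> vec_module.orthogonal_complement d {w}"
      using col_in_col_space[OF Z that] assms(15) by simp
    then have "col Z j \<in> carrier_vec d" "col Z j \<bullet> w = 0"
      by (simp_all add: vec_module.orthogonal_complement_def)
    then show ?thesis
      using a u w comm_scalar_prod[OF u(1), of "col Z j"] by (simp add: wu)
  qed
  have oB: "orthonormal_mat d d B"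
    unfolding B_def using orthonormal_mat_Cons_col[of u "d - 1" Z] u assms(1,14) perp by simp
  have Bc: "B \<in> carrier_mat d d" using oB by (simp add: orthonormal_mat_def)
  have W: "W = B\<^sup>T"
    using assms(16) w by (simp add: aligning_mat_def B_def u_def)
  have oW: "orthonormal_mat d d W" using orthonormal_mat_square(2)[OF oB] W by simp
  have B0: "col B 0 = u"
    unfolding B_def using u by (subst col_mat_of_cols) auto
  have uB: "u \<bullet> col B j = (if j = 0 then 1 else 0)" if "j < d" for j
    using orthonormal_mat_iff_cols[OF Bc] oB that assms(1) B0 by metis
  define p where "p j = (if j = 0 then vsnoc (c \<cdot>\<^sub>v col B 0) t
    else if j < d then vsnoc (col B j) 0 else vsnoc ((- t) \<cdot>\<^sub>v col B 0) c)" for j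
  define P where "P = mat_of_cols (Suc d) (map p [0..<Suc d])"
  have "\<exists>S Q. is_svd (isvd_core w b) P S Q"
    unfolding P_def p_def using assms(1) oB wu ct L b
    by (intro isvd_core_svd[where a = a and L = "lam a b" and M = "b\<^sup>2 / lam a b"])
      (simp_all add: B0)
  then obtain S Q where svd: "is_svd (isvd_core w b) P S Q" by blast
  have p_carrier: "p j \<in> carrier_vec (Suc d)" for j
    using Bc by (intro carrier_vecI) (auto simp: p_def)
  \<comment> \<open>The column removed is \<open>p d\<close>, that is \<open>(- t u, c)\<close>,
    which belongs to the smallest singular value.\<close>
  have butlast_P: "mat_of_cols (dim_row P) (butlast (cols P)) = mat_of_cols (Suc d) (map p [0..<d])"
  proof -
    have "cols P = map p [0..<Suc d]"
      unfolding P_def using p_carrier by (intro cols_mat_of_cols) auto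
    then show ?thesis by (simp add: P_def butlast_append)
  qed
  define V where "V = mat_of_cols n (cols U @ [normalize_vec r])"
  define H where "H = mat_of_cols (Suc d) (map p [0..<d])"
  define G where "G = grouse_iterate U \<Omega> v w \<eta>"
  have V: "V \<in> carrier_mat n (Suc d)" using U by (intro carrier_matI) (auto simp: V_def)
  have H: "H \<in> carrier_mat (Suc d) d" by (intro carrier_matI) (simp_all add: H_def)
  define X where "X = outer_prod (normalize_vec (U *\<^sub>v w)) u"
  define Y where "Y = outer_prod (normalize_vec r) u"
  have X: "X \<in> carrier_mat n d" and Y: "Y \<in> carrier_mat n d"
    using outer_prod_carrier[of "normalize_vec (U *\<^sub>v w)" u] outer_prod_carrier[of "normalize_vec r" u]
      U u r by (auto simp: X_def Y_def)
  have G: "G = U + (c - 1) \<cdot>\<^sub>m X + t \<cdot>\<^sub>m Y"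
    unfolding G_def grouse_iterate_def Let_def assms(10,12)[symmetric] \<sigma>\<eta> cos sin X_def Y_def u_def ..
  have Gc: "G \<in> carrier_mat n d" using U X Y by (simp add: G)
  \<comment> \<open>\<open>U\<close> preserves norms, so normalizing commutes with applying
    \<open>U\<close>.\<close>
  have nUw: "normalize_vec (U *\<^sub>v w) = U *\<^sub>v u"
    using a U u by (simp add: normalize_vec_def[of "U *\<^sub>v w"] norm_Uw)
      (simp add: wu mult_mat_vec smult_smult_assoc)
  \<comment> \<open>Column 0 of either side is \<open>c U u + t r / \<parallel>r\<parallel>\<close>.
    In a column \<open>j > 0\<close> the rank-one terms vanish, since column \<open>j\<close> of
    \<open>B\<close> is orthogonal to \<open>u\<close>, and \<open>U\<close> times that column
    remains.\<close>
  have GB: "G * B = V * H"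
  proof (rule mat_col_eqI)
    fix j assume "j < dim_col (V * H)"
    then have j: "j < d" using H by simp
    have Bj: "col B j \<in> carrier_vec d" using Bc by (intro carrier_vecI) simp
    have "col (G * B) j = G *\<^sub>v col B j"
      using Gc Bc j by (rule col_mult2)
    also have "\<dots> = U *\<^sub>v col B j + (c - 1) \<cdot>\<^sub>v (X *\<^sub>v col B j) + t \<cdot>\<^sub>v (Y *\<^sub>v col B j)"
      unfolding G using U X Y Bj Bc
      by (simp add: assoc_add_vec[of _ n] add_mult_distrib_mat_vec[of _ n d] smult_mat_mult_vec)
    also have "X *\<^sub>v col B j = (u \<bullet> col B j) \<cdot>\<^sub>v (U *\<^sub>v u)"
      unfolding X_def nUw using Bj u by (intro outer_prod_mult_vec) simp
    also have "Y *\<^sub>v col B j = (u \<bullet> col B j) \<cdot>\<^sub>v normalize_vec r"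
      unfolding Y_def using Bj u by (intro outer_prod_mult_vec) simp
    also have "U *\<^sub>v col B j + (c - 1) \<cdot>\<^sub>v ((u \<bullet> col B j) \<cdot>\<^sub>v (U *\<^sub>v u))
        + t \<cdot>\<^sub>v ((u \<bullet> col B j) \<cdot>\<^sub>v normalize_vec r) = V *\<^sub>v p j"
    proof (cases "j = 0")
      case True
      have "V *\<^sub>v p j = U *\<^sub>v (c \<cdot>\<^sub>v u) + t \<cdot>\<^sub>v normalize_vec r"
        unfolding V_def using True U r u
        by (simp add: p_def B0 mat_of_cols_snoc_mult_vec)
      also have "\<dots> = c \<cdot>\<^sub>v (U *\<^sub>v u) + t \<cdot>\<^sub>v normalize_vec r"
        using U u by (simp add: mult_mat_vec)
      finally show ?thesis
        using True uB[OF j] U u r B0 by (intro eq_vecI) (auto simp: algebra_simps)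
    next
      case False
      have "V *\<^sub>v p j = U *\<^sub>v col B j + 0 \<cdot>\<^sub>v normalize_vec r"
        unfolding V_def using False j U r Bj
        by (simp add: p_def mat_of_cols_snoc_mult_vec)
      then show ?thesis
        using False uB[OF j] U r by (intro eq_vecI) auto
    qed
    also have "p j = col H j"
      unfolding H_def using j p_carrier by (subst col_mat_of_cols) auto
    also have "V *\<^sub>v col H j = col (V * H) j"
      using V H j by (rule col_mult2[symmetric])
    finally show "col (G * B) j = col (V * H) j" .
  qed (use Gc V Bc H in auto)
  \<comment> \<open>\<open>W = B\<^sup>T\<close> undoes the multiplication by \<open>B\<close>; the
    decomposition \<open>P\<close>, \<open>S\<close>, \<open>Q\<close> is then the witness for
    membership in the set of iSVD iterates.\<close>
  have "G = G * (B * B\<^sup>T)"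
    using orthonormal_mat_square(1)[OF oB] Gc by simp
  also have "\<dots> = V * H * W"
    using Gc Bc unfolding W GB[symmetric] by (intro assoc_mult_mat[symmetric]) auto
  finally have "G = mat_of_cols (dim_row U) (cols U @ [normalize_vec r])
      * mat_of_cols (dim_row P) (butlast (cols P)) * W"
    using U by (simp add: V_def H_def butlast_P)
  then have "G \<in> isvd_iterates U \<Omega> v w W"
    using svd assms(10)
    by (auto simp: isvd_iterates_def Let_def isvd_residual_eq_grouse_residual b_def)
  moreover have "0 < \<eta>" using \<theta> \<open>0 < \<sigma>\<close> by (simp add: \<eta>)
  ultimately show ?thesis
    using eta_arccos oW by (simp add: G_def)
qed

end
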